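(* Suppose that $X,Y \in \mathcal{M}_n(\mathbb{R})$ are symmetric. Let $\mathbf{x} = \mathrm{diag}(X)$ and $\mathbf{y} = \mathrm{diag}(Y)$, and let $\lambda_X$ and $\lambda_Y$ be the vectors of the eigenvalues (with multiplicity) of $X$ and $Y$, respectively, sorted in opposite order (i.e., one sorted from largest to smallest and the other sorted from smallest to largest). Then \[ \|\mathbf{x}\|\|\mathbf{y}\| - \langle \mathbf{x},\mathbf{y}\rangle \leq \|\lambda_X\|\|\lambda_Y\| - \langle \lambda_X,\lambda_Y\rangle. \]
   Context: $\mathcal{M}_n(\mathbb{R})$ is the set of real $n\times n$ matrices. $\mathrm{diag}(X)\in\mathbb{R}^n$ is the vector of diagonal entries $(x_{1,1},\ldots,x_{n,n})$ of $X$. $\langle\cdot,\cdot\rangle$ and $\|\cdot\|$ are the usual dot product and Euclidean norm on $\mathbb{R}^n$. *)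

theory Defs
  imports
    "Jordan_Normal_Form.Char_Poly"
    "HOL-Computational_Algebra.Computational_Algebra"
begin

definition symmetric_mat :: "'a mat \<Rightarrow> bool" where
  "symmetric_mat A \<longleftrightarrow> A\<^sup>T = A"

definition diag_vec :: "'a mat \<Rightarrow> 'a vec" where
  "diag_vec A = vec_of_list (diag_mat A)"

definition vec_norm :: "real vec \<Rightarrow> real" where
  "vec_norm v = sqrt (v \<bullet> v)"

text \<open>
  The entries of \<open>v\<close>, in some order, are the (real) eigenvalues of \<open>A\<close>, each listed as often as
  its multiplicity as a root of the characteristic polynomial.  The dimension of \<open>v\<close> is not
  prescribed: for a symmetric matrix it equals that of \<open>A\<close> by the spectral theorem.
\<close>
definition eigenvalue_vec :: "real mat \<Rightarrow> real vec \<Rightarrow> bool" where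
  "eigenvalue_vec A v \<longleftrightarrow> mset (list_of_vec v) = proots (char_poly A)"

lemma eigenvalue_vec_set:
  assumes "A \<in> carrier_mat n n" "eigenvalue_vec A v"
  shows "set\<^sub>v v = {e. eigenvalue A e}"
proof -
  have "char_poly A \<noteq> 0"
    using degree_monic_char_poly[OF assms(1)] by auto
  moreover have "set\<^sub>v v = set_mset (proots (char_poly A))"
    using assms(2) by (metis eigenvalue_vec_def set_list_of_vec set_mset_mset)
  ultimately show ?thesis
    by (simp add: eigenvalue_root_char_poly[OF assms(1)])
qed

definition vec_increasing :: "real vec \<Rightarrow> bool" where
  "vec_increasing v \<longleftrightarrow> sorted_wrt (\<le>) (list_of_vec v)"

definition vec_decreasing :: "real vec \<Rightarrow> bool" where
  "vec_decreasing v \<longleftrightarrow> sorted_wrt (\<ge>) (list_of_vec v)"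

end

theory Submission
  imports Defs
begin

text \<open>
  Write \<open>a\<close> and \<open>b\<close> for the two vectors of eigenvalues and \<open>x\<close>, \<open>y\<close> for the two diagonals. The
  inequality is the sum of two independent ones, \<open>\<parallel>x\<parallel> \<parallel>y\<parallel> \<le> \<parallel>a\<parallel> \<parallel>b\<parallel>\<close> and
  \<open>\<langle>a, b\<rangle> \<le> \<langle>x, y\<rangle>\<close>.

  Both rest on Schur's observation: if \<open>X = P diag(a) P\<^sup>T\<close> with \<open>P\<close> orthogonal, then the \<open>i\<close>-th
  diagonal entry of \<open>X\<close> is the sum of \<open>P\<^sub>i\<^sub>k\<^sup>2 a\<^sub>k\<close> over \<open>k\<close>, and the squares \<open>P\<^sub>i\<^sub>k\<^sup>2\<close> form a
  doubly stochastic matrix (\<open>diag_doubly_stochastic_image_eigenvalues\<close>). So \<open>x = S a\<close> and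
  \<open>y = T b\<close> for doubly stochastic \<open>S\<close> and \<open>T\<close>. Averaging with such a matrix cannot increase the
  Euclidean norm (\<open>doubly_stochastic_sum_squares_le\<close>), which gives the first inequality. For the
  second, \<open>\<langle>S a, T b\<rangle> = \<langle>a, S\<^sup>T T b\<rangle>\<close>, where \<open>S\<^sup>T T\<close> is again doubly stochastic, and among all
  doubly stochastic \<open>D\<close> the value \<open>\<langle>a, D b\<rangle>\<close> is least at the identity when \<open>a\<close> and \<open>b\<close> are
  oppositely sorted (\<open>doubly_stochastic_rearrangement\<close>). The latter is the rearrangement
  inequality for doubly stochastic matrices. In place of the decomposition into permutation
  matrices its proof exhibits an optimal dual solution of the assignment problem.

  The spectral theorem is proved by deflation: a Householder reflection carries the first basis
  vector to a unit eigenvector and so splits off one eigenvalue.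
\<close>

(* The dollar sign denotes vector indexing throughout. *)
no_notation fps_nth (infixl "$" 75)

section \<open>Doubly stochastic matrices and rearrangement\<close>

definition doubly_stochastic :: "nat \<Rightarrow> (nat \<Rightarrow> nat \<Rightarrow> real) \<Rightarrow> bool" where
  "doubly_stochastic n S \<longleftrightarrow> (\<forall>i<n. \<forall>j<n. 0 \<le> S i j) \<and>
     (\<forall>i<n. (\<Sum>j<n. S i j) = 1) \<and> (\<forall>j<n. (\<Sum>i<n. S i j) = 1)"

lemma doubly_stochastic_transpose_mult:
  assumes S: "doubly_stochastic n S" and T: "doubly_stochastic n T"
  shows "doubly_stochastic n (\<lambda>k l. \<Sum>i<n. S i k * T i l)"
proof -
  have "(\<Sum>l<n. \<Sum>i<n. S i k * T i l) = 1" if "k < n" for k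
  proof -
    have "(\<Sum>l<n. \<Sum>i<n. S i k * T i l) = (\<Sum>i<n. S i k * (\<Sum>l<n. T i l))"
      by (subst sum.swap) (simp add: sum_distrib_left)
    then show ?thesis
      using S T that by (simp add: doubly_stochastic_def)
  qed
  moreover have "(\<Sum>k<n. \<Sum>i<n. S i k * T i l) = 1" if "l < n" for l
  proof -
    have "(\<Sum>k<n. \<Sum>i<n. S i k * T i l) = (\<Sum>i<n. (\<Sum>k<n. S i k) * T i l)"
      by (subst sum.swap) (simp add: sum_distrib_right)
    then show ?thesis
      using S T that by (simp add: doubly_stochastic_def)
  qed
  ultimately show ?thesis
    using S T by (auto simp: doubly_stochastic_def intro!: sum_nonneg mult_nonneg_nonneg)
qed

text \<open>
  Each row of \<open>S\<close> is a probability vector, so Jensen's inequality for the square applies to it;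
  summing over the rows, the column sums turn the bound into the sum of the squares of \<open>a\<close>.
\<close>
lemma doubly_stochastic_sum_squares_le:
  assumes S: "doubly_stochastic n S"
  shows "(\<Sum>i<n. (\<Sum>k<n. S i k * a k)\<^sup>2) \<le> (\<Sum>k<n. (a k)\<^sup>2)"
proof -
  have "(\<Sum>k<n. S i k * a k)\<^sup>2 \<le> (\<Sum>k<n. S i k * (a k)\<^sup>2)" if i: "i < n" for i
  proof -
    (* Jensen, by nonnegativity of the variance of a under the weights S i. *)
    define m where "m = (\<Sum>k<n. S i k * a k)"
    have "0 \<le> (\<Sum>k<n. S i k * (a k - m)\<^sup>2)"
      using S i by (auto simp: doubly_stochastic_def intro!: sum_nonneg mult_nonneg_nonneg)
    also have "\<dots> = (\<Sum>k<n. S i k * (a k)\<^sup>2 - 2 * m * (S i k * a k) + m\<^sup>2 * S i k)"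
      by (intro sum.cong refl) (simp add: power2_eq_square algebra_simps)
    also have "\<dots> = (\<Sum>k<n. S i k * (a k)\<^sup>2) - 2 * m * m + m\<^sup>2 * (\<Sum>k<n. S i k)"
      by (simp add: sum.distrib sum_subtractf sum_distrib_left m_def)
    also have "\<dots> = (\<Sum>k<n. S i k * (a k)\<^sup>2) - m\<^sup>2"
      using S i by (simp add: doubly_stochastic_def power2_eq_square)
    finally show ?thesis by (simp add: m_def)
  qed
  then have "(\<Sum>i<n. (\<Sum>k<n. S i k * a k)\<^sup>2) \<le> (\<Sum>i<n. \<Sum>k<n. S i k * (a k)\<^sup>2)"
    by (intro sum_mono) auto
  also have "\<dots> = (\<Sum>k<n. (\<Sum>i<n. S i k) * (a k)\<^sup>2)"
    by (subst sum.swap) (simp add: sum_distrib_right)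
  also have "\<dots> = (\<Sum>k<n. (a k)\<^sup>2)"
    using S by (simp add: doubly_stochastic_def)
  finally show ?thesis .
qed

text \<open>
  Minimising the right-hand side over doubly stochastic \<open>D\<close> is an assignment problem with costs
  \<open>a i * b j\<close>. By linear programming duality the identity assignment is optimal as soon as there are
  potentials \<open>u\<close> and \<open>v\<close> with \<open>u i + v j \<le> a i * b j\<close> for all \<open>i\<close>, \<open>j\<close> and with equality on the
  diagonal: then summing against \<open>D\<close> gives the claim, since the row and column sums of \<open>D\<close> are one.
  Equality on the diagonal forces \<open>u i = a i * b i - v i\<close>. The step from \<open>j\<close> to \<open>Suc j\<close> raises the
  cost in row \<open>i\<close> by \<open>a i * (b (Suc j) - b j)\<close>, so letting \<open>v\<close> grow there by
  \<open>a j * (b (Suc j) - b j)\<close> makes \<open>v\<close> grow more slowly than the costs to the right of the diagonal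
  and faster to its left, because \<open>a\<close> decreases and \<open>b\<close> increases.
\<close>
lemma doubly_stochastic_rearrangement:
  fixes a b :: "nat \<Rightarrow> real"
  assumes D: "doubly_stochastic n D"
    and a: "\<And>i j. i \<le> j \<Longrightarrow> j < n \<Longrightarrow> a j \<le> a i"
    and b: "\<And>i j. i \<le> j \<Longrightarrow> j < n \<Longrightarrow> b i \<le> b j"
  shows "(\<Sum>i<n. a i * b i) \<le> (\<Sum>i<n. \<Sum>j<n. D i j * (a i * b j))"
proof -
  define v where "v j = (\<Sum>k<j. a k * (b (Suc k) - b k))" for j
  have dual: "a i * b i - v i + v j \<le> a i * b j" if i: "i < n" and j: "j < n" for i j
  proof (cases "i \<le> j")
    case True
    then show ?thesis
      using j
    proof (induction j rule: dec_induct)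
      case (step j)
      have "a j * (b (Suc j) - b j) \<le> a i * (b (Suc j) - b j)"
        using a[of i j] b[of j "Suc j"] step by (intro mult_right_mono) auto
      with step show ?case by (simp add: v_def algebra_simps)
    qed simp
  next
    case False
    then have "j \<le> i" by simp
    then show ?thesis
    proof (induction j rule: inc_induct)
      case (step j)
      have "a i * (b (Suc j) - b j) \<le> a j * (b (Suc j) - b j)"
        using a[of j i] b[of j "Suc j"] step i by (intro mult_right_mono) auto
      with step show ?case by (simp add: v_def algebra_simps)
    qed simp
  qed
  have "(\<Sum>i<n. a i * b i) = (\<Sum>i<n. a i * b i - v i) + (\<Sum>j<n. v j)"
    by (simp add: sum_subtractf)
  also have "\<dots> = (\<Sum>i<n. (\<Sum>j<n. D i j) * (a i * b i - v i)) + (\<Sum>j<n. (\<Sum>i<n. D i j) * v j)"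
    using D by (simp add: doubly_stochastic_def)
  also have "(\<Sum>j<n. (\<Sum>i<n. D i j) * v j) = (\<Sum>i<n. \<Sum>j<n. D i j * v j)"
    unfolding sum_distrib_right by (rule sum.swap)
  also have "(\<Sum>i<n. (\<Sum>j<n. D i j) * (a i * b i - v i)) + (\<Sum>i<n. \<Sum>j<n. D i j * v j)
      = (\<Sum>i<n. \<Sum>j<n. D i j * (a i * b i - v i + v j))"
    by (simp add: sum_distrib_right sum.distrib[symmetric] distrib_left)
  also have "\<dots> \<le> (\<Sum>i<n. \<Sum>j<n. D i j * (a i * b j))"
    using D dual by (intro sum_mono mult_left_mono) (auto simp: doubly_stochastic_def)
  finally show ?thesis .
qed

text \<open>
  This is the rearrangement inequality for \<open>D = S\<^sup>T T\<close>, because \<open>\<langle>S a, T b\<rangle> = \<langle>a, S\<^sup>T T b\<rangle>\<close>.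
\<close>
lemma sum_doubly_stochastic_images_ge:
  fixes a b :: "nat \<Rightarrow> real"
  assumes S: "doubly_stochastic n S" and T: "doubly_stochastic n T"
    and a: "\<And>i j. i \<le> j \<Longrightarrow> j < n \<Longrightarrow> a j \<le> a i"
    and b: "\<And>i j. i \<le> j \<Longrightarrow> j < n \<Longrightarrow> b i \<le> b j"
  shows "(\<Sum>k<n. a k * b k) \<le> (\<Sum>i<n. (\<Sum>k<n. S i k * a k) * (\<Sum>l<n. T i l * b l))"
proof -
  have "(\<Sum>k<n. a k * b k) \<le> (\<Sum>k<n. \<Sum>l<n. (\<Sum>i<n. S i k * T i l) * (a k * b l))"
    by (intro doubly_stochastic_rearrangement doubly_stochastic_transpose_mult S T a b)
  also have "\<dots> = (\<Sum>k<n. \<Sum>i<n. \<Sum>l<n. S i k * a k * (T i l * b l))"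
    unfolding sum_distrib_right
    by (rule sum.cong[OF refl], subst sum.swap) (simp add: ac_simps)
  also have "\<dots> = (\<Sum>i<n. (\<Sum>k<n. S i k * a k) * (\<Sum>l<n. T i l * b l))"
    by (subst sum.swap) (simp add: sum_product)
  finally show ?thesis .
qed

section \<open>Spectral theorem for real symmetric matrices\<close>

lemma symmetric_mat_index:
  assumes "symmetric_mat X" "X \<in> carrier_mat n n" "i < n" "j < n"
  shows "X $$ (i, j) = X $$ (j, i)"
  using assms by (metis carrier_matD index_transpose_mat(1) symmetric_mat_def)

text \<open>
  The quadratic form \<open>v\<^sup>* X v\<close> of a complex eigenvector \<open>v\<close> is its own conjugate, as \<open>X\<close> is real and
  symmetric, and it equals \<open>z \<parallel>v\<parallel>\<^sup>2\<close>.
\<close>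
lemma symmetric_mat_complex_eigenvalue_real:
  fixes X :: "real mat"
  assumes X: "X \<in> carrier_mat n n" and sym: "symmetric_mat X"
    and ev: "eigenvalue (map_mat complex_of_real X) z"
  shows "z \<in> \<real>"
proof -
  let ?A = "map_mat complex_of_real X"
  obtain v where v: "v \<in> carrier_vec n" "v \<noteq> 0\<^sub>v n" and Av: "?A *\<^sub>v v = z \<cdot>\<^sub>v v"
    using ev X by (auto simp: eigenvalue_def eigenvector_def)
  have Avi: "(\<Sum>j<n. X $$ (i, j) * v $ j) = z * v $ i" if "i < n" for i
  proof -
    have "(?A *\<^sub>v v) $ i = (\<Sum>j<n. X $$ (i, j) * v $ j)"
      using X v that by (simp add: scalar_prod_def atLeast0LessThan)
    then show ?thesis using Av v that by simp
  qed
  define q where "q = (\<Sum>i<n. cnj (v $ i) * (\<Sum>j<n. X $$ (i, j) * v $ j))"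
  have "cnj q = (\<Sum>i<n. \<Sum>j<n. X $$ (i, j) * v $ i * cnj (v $ j))"
    by (simp add: q_def sum_distrib_left ac_simps)
  also have "\<dots> = (\<Sum>j<n. \<Sum>i<n. X $$ (i, j) * v $ i * cnj (v $ j))"
    by (rule sum.swap)
  also have "\<dots> = q"
    using symmetric_mat_index[OF sym X] by (simp add: q_def sum_distrib_left ac_simps)
  finally have q_real: "q \<in> \<real>" by (simp add: Reals_cnj_iff)
  define r where "r = (\<Sum>i<n. (cmod (v $ i))\<^sup>2)"
  have "q = (\<Sum>i<n. cnj (v $ i) * (z * v $ i))"
    by (simp add: q_def Avi)
  also have "\<dots> = z * complex_of_real r"
    by (simp add: r_def sum_distrib_left complex_norm_square ac_simps del: of_real_power)
  finally have "q = z * complex_of_real r" .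
  moreover have "r \<noteq> 0"
  proof
    assume "r = 0"
    then have "v $ i = 0" if "i < n" for i
      using that by (simp add: r_def sum_nonneg_eq_0_iff)
    then have "v = 0\<^sub>v n" using v by (intro eq_vecI) auto
    with v show False by simp
  qed
  ultimately have "z = q / complex_of_real r" by simp
  then show ?thesis using q_real by simp
qed

text \<open>
  Over the complex numbers the characteristic polynomial splits, and its roots are real by the
  preceding lemma, so the factorisation descends to the reals.
\<close>
lemma symmetric_char_poly_splits:
  fixes X :: "real mat"
  assumes X: "X \<in> carrier_mat n n" and sym: "symmetric_mat X"
  obtains es where "char_poly X = (\<Prod>e\<leftarrow>es. [:- e, 1:])" "length es = n"
proof -
  let ?A = "map_mat complex_of_real X"
  have A: "?A \<in> carrier_mat n n" using X by simp
  obtain zs where zs: "char_poly ?A = (\<Prod>z\<leftarrow>zs. [:- z, 1:])" "length zs = n"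
    using char_poly_factorized[OF A] by blast
  have real: "complex_of_real (Re z) = z" if "z \<in> set zs" for z
  proof -
    have "poly (char_poly ?A) z = 0"
      using that by (simp add: zs(1) poly_prod_list prod_list_zero_iff)
    then have "eigenvalue ?A z" by (simp add: eigenvalue_root_char_poly[OF A])
    then show ?thesis
      using symmetric_mat_complex_eigenvalue_real[OF X sym] of_real_Re by blast
  qed
  interpret map_poly_inj_comm_ring_hom complex_of_real ..
  have "map_poly complex_of_real (\<Prod>e\<leftarrow>map Re zs. [:- e, 1:]) = (\<Prod>z\<leftarrow>zs. [:- z, 1:])"
    using real by (simp add: hom_prod_list o_def cong: map_cong)
  also have "\<dots> = map_poly complex_of_real (char_poly X)"
    using zs(1) of_real_hom.char_poly_hom[OF X, where 'a = complex] by simp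
  finally have "char_poly X = (\<Prod>e\<leftarrow>map Re zs. [:- e, 1:])" by simp
  with zs(2) show ?thesis by (intro that[of "map Re zs"]) simp_all
qed

text \<open>
  A real polynomial may have fewer real roots than its degree; the splitting excludes this for
  \<open>X\<close>, so that \<open>l\<close> lists all \<open>n\<close> eigenvalues.
\<close>
lemma eigenvalue_vec_char_poly:
  assumes X: "X \<in> carrier_mat n n" and sym: "symmetric_mat X" and l: "eigenvalue_vec X l"
  shows "dim_vec l = n" "char_poly X = (\<Prod>e\<leftarrow>list_of_vec l. [:- e, 1:])"
proof -
  obtain es where es: "char_poly X = (\<Prod>e\<leftarrow>es. [:- e, 1:])" "length es = n"
    using symmetric_char_poly_splits[OF X sym] .
  have "proots (\<Prod>e\<leftarrow>es. [:- e, 1:]) = mset es"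
    by (induction es) (simp_all add: proots_mult prod_list_zero_iff image_iff del: mult_pCons_left)
  then have perm: "mset (list_of_vec l) = mset es"
    using l es by (simp add: eigenvalue_vec_def)
  from mset_eq_length[OF perm] es show "dim_vec l = n" by simp
  have "prod_mset (image_mset (\<lambda>e. [:- e, 1:]) (mset (list_of_vec l)))
      = prod_mset (image_mset (\<lambda>e. [:- e, 1:]) (mset es))"
    by (simp only: perm)
  then show "char_poly X = (\<Prod>e\<leftarrow>list_of_vec l. [:- e, 1:])"
    by (simp add: es(1) prod_mset_prod_list flip: mset_map)
qed

text \<open>
  \<open>H\<close> is the Householder reflection in the hyperplane orthogonal to \<open>u = v - e\<^sub>0\<close>, which exchanges
  the unit vectors \<open>v\<close> and \<open>e\<^sub>0\<close>. If \<open>v = e\<^sub>0\<close> there is no such hyperplane; then the denominator of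
  \<open>c\<close> is zero, hence \<open>c = 0\<close> since division by zero yields zero, and \<open>H\<close> is the identity, as it
  should be. An orthogonal completion of \<open>v\<close> that is also symmetric spares all transposes.
\<close>
lemma orthogonal_symmetric_with_first_column:
  fixes v :: "real vec"
  assumes v: "v \<in> carrier_vec n" and unit: "v \<bullet> v = 1" and n: "0 < n"
  obtains H where "H \<in> carrier_mat n n" "H\<^sup>T = H" "H * H = 1\<^sub>m n" "col H 0 = v"
proof -
  define u where "u = (\<lambda>i. v $ i - (if i = 0 then 1 else 0))"
  define c where "c = 2 / (\<Sum>i<n. (u i)\<^sup>2)"
  define H where "H = mat n n (\<lambda>(i, j). (if i = j then 1 else 0) - c * u i * u j)"
  have vv: "(\<Sum>i<n. (v $ i)\<^sup>2) = 1"
    using unit v by (simp add: scalar_prod_def atLeast0LessThan power2_eq_square)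
  have "(\<Sum>i<n. (u i)\<^sup>2)
      = (\<Sum>i<n. (v $ i)\<^sup>2 - (if i = 0 then 2 * v $ 0 - 1 else 0))"
    by (intro sum.cong) (auto simp: u_def power2_eq_square algebra_simps)
  then have uu: "(\<Sum>i<n. (u i)\<^sup>2) = - 2 * u 0"
    using n vv by (simp add: sum_subtractf u_def)
  have u_0: "u i = 0" if "u 0 = 0" "i < n" for i
    using uu that by (simp add: sum_nonneg_eq_0_iff)
  have cc: "c * c * (\<Sum>i<n. (u i)\<^sup>2) = 2 * c"
    by (simp add: c_def)
  have H: "H \<in> carrier_mat n n" by (simp add: H_def)
  have Ht: "H\<^sup>T = H" by (rule eq_matI) (auto simp: H_def)
  have "H * H = 1\<^sub>m n"
  proof (rule eq_matI)
    fix i j assume "i < dim_row (1\<^sub>m n :: real mat)" "j < dim_col (1\<^sub>m n :: real mat)"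
    then have i: "i < n" and j: "j < n" by simp_all
    let ?d = "\<lambda>i j :: nat. if i = j then 1 else 0 :: real"
    have "(H * H) $$ (i, j) = (\<Sum>k<n. (?d i k - c * u i * u k) * (?d k j - c * u k * u j))"
      using i j by (simp add: H_def scalar_prod_def atLeast0LessThan)
    also have "\<dots> = (\<Sum>k<n. (if k = i then ?d k j - c * u k * u j else 0)
        - (if k = j then c * u i * u k else 0) + c * c * u i * u j * (u k)\<^sup>2)"
      by (intro sum.cong) (auto simp: power2_eq_square algebra_simps)
    also have "\<dots> = ?d i j - 2 * c * u i * u j + (c * c * (\<Sum>k<n. (u k)\<^sup>2)) * (u i * u j)"
      using i j by (simp add: sum.distrib sum_subtractf sum_distrib_left sum_distrib_right ac_simps)
    also have "\<dots> = 1\<^sub>m n $$ (i, j)"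
      using i j by (simp add: cc)
    finally show "(H * H) $$ (i, j) = 1\<^sub>m n $$ (i, j)" .
  qed (simp_all add: H_def)
  moreover have "col H 0 = v"
  proof (rule eq_vecI)
    fix i assume "i < dim_vec v"
    then have i: "i < n" using v by simp
    have "c * u i * u 0 = - u i"
      using u_0[OF _ i] by (cases "u 0 = 0") (simp_all add: c_def uu)
    then show "col H 0 $ i = v $ i"
      using i n by (auto simp: H_def u_def)
  qed (use v in \<open>simp add: H_def\<close>)
  ultimately show ?thesis using that H Ht by blast
qed

text \<open>
  The eigenvalues are prescribed as a list, in any order, and enter the diagonal in this order, so
  that no permutation has to be applied afterwards to match a sorted vector of eigenvalues.

  If the unit vector \<open>v\<close> is an eigenvector for the first of them and \<open>H\<close> a reflection taking \<open>e\<^sub>0\<close> to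
  \<open>v\<close>, then \<open>e\<^sub>0\<close> is an eigenvector of \<open>H X H\<close>. By symmetry this matrix is block diagonal; its
  lower block is symmetric with the remaining eigenvalues, so induction applies to it.
\<close>
theorem spectral_theorem_real_symmetric:
  fixes X :: "real mat"
  assumes "X \<in> carrier_mat n n" and "symmetric_mat X"
    and "char_poly X = (\<Prod>e\<leftarrow>es. [:- e, 1:])"
  shows "\<exists>P \<in> carrier_mat n n. P * P\<^sup>T = 1\<^sub>m n \<and> X = P * mat_diag n ((!) es) * P\<^sup>T"
  using assms
proof (induction es arbitrary: n X)
  case Nil
  then have "n = 0" using degree_monic_char_poly[of X n] by simp
  with Nil show ?case by (intro bexI[of _ "1\<^sub>m 0"]) auto
next
  case (Cons e es)
  note X = Cons.prems(1) and sym = Cons.prems(2) and cp = Cons.prems(3)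
  have "n \<noteq> 0"
  proof
    assume "n = 0"
    then have "char_poly X = 1"
      using degree_monic_char_poly[OF X] by (metis coeff_0 lead_coeff_pCons(1) monic_degree_0)
    moreover have "poly (char_poly X) e = 0" by (simp add: cp)
    ultimately show False by simp
  qed
  then obtain m where n: "n = Suc m" by (cases n) auto
  have "eigenvalue X e"
    by (simp add: eigenvalue_root_char_poly[OF X] cp)
  then obtain w where w: "w \<in> carrier_vec n" "w \<noteq> 0\<^sub>v n" "X *\<^sub>v w = e \<cdot>\<^sub>v w"
    using X by (auto simp: eigenvalue_def eigenvector_def)
  have ww: "0 < w \<bullet> w"
    using conjugate_square_greater_0_vec[OF w(1)] w(2) by simp
  define v where "v = (1 / sqrt (w \<bullet> w)) \<cdot>\<^sub>v w"
  have v: "v \<in> carrier_vec n" using w by (simp add: v_def)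
  have "v \<bullet> v = 1"
    using w(1) ww by (simp add: v_def)
  then obtain H where H: "H \<in> carrier_mat n n" "H\<^sup>T = H" "H * H = 1\<^sub>m n" "col H 0 = v"
    using orthogonal_symmetric_with_first_column[OF v] n by blast
  have Xv: "X *\<^sub>v v = e \<cdot>\<^sub>v v"
    using X w by (simp add: v_def mult_mat_vec smult_smult_assoc ac_simps)
  define B where "B = H * X * H"
  have B: "B \<in> carrier_mat n n" using H X by (simp add: B_def)
  have X_B: "X = H * B * H"
  proof -
    have "H * B * H = (H * H) * X * (H * H)"
      unfolding B_def using H(1) X by (simp add: assoc_mult_mat[of _ n n _ n _ n])
    then show ?thesis using H X by simp
  qed
  have B_sym: "B\<^sup>T = B"
    unfolding B_def using H X sym
    by (simp add: transpose_mult[of _ n n _ n] assoc_mult_mat[of _ n n _ n _ n] symmetric_mat_def)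
  have "col B 0 = (H * X) *\<^sub>v col H 0"
    unfolding B_def using H(1) X n by (intro col_mult2[of _ n n _ n]) auto
  also have "\<dots> = H *\<^sub>v (X *\<^sub>v col H 0)"
    using H(1) X v by (intro assoc_mult_mat_vec[of _ n n _ n]) (auto simp: H(4))
  also have "\<dots> = e \<cdot>\<^sub>v (H *\<^sub>v col H 0)"
    using H(1) v by (simp add: H(4) Xv mult_mat_vec)
  also have "H *\<^sub>v col H 0 = col (H * H) 0"
    using H(1) n by (intro col_mult2[symmetric, of _ n n _ n]) auto
  also have "\<dots> = unit_vec n 0" using n by (simp add: H(3))
  finally have col0: "col B 0 = e \<cdot>\<^sub>v unit_vec n 0" .
  have B_i0: "B $$ (i, 0) = (if i = 0 then e else 0)" if "i < n" for i
    using arg_cong[OF col0, of "\<lambda>v. v $ i"] B n that by (auto simp: unit_vec_def)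
  define Z where "Z = mat m m (\<lambda>(i, j). B $$ (Suc i, Suc j))"
  have Z: "Z \<in> carrier_mat m m" by (simp add: Z_def)
  let ?E = "mat 1 1 (\<lambda>_. e)"
  have B_ij: "B $$ (i, j) = B $$ (j, i)" if "i < n" "j < n" for i j
    using symmetric_mat_index[of B n] B B_sym that by (simp add: symmetric_mat_def)
  have B_block: "B = four_block_mat ?E (0\<^sub>m 1 m) (0\<^sub>m m 1) Z"
  proof (rule eq_matI)
    fix i j
    assume "i < dim_row (four_block_mat ?E (0\<^sub>m 1 m) (0\<^sub>m m 1) Z)"
      and "j < dim_col (four_block_mat ?E (0\<^sub>m 1 m) (0\<^sub>m m 1) Z)"
    then have "i < n" "j < n" using Z n by auto
    then show "B $$ (i, j) = four_block_mat ?E (0\<^sub>m 1 m) (0\<^sub>m m 1) Z $$ (i, j)"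
      using B_i0[of i] B_i0[of j] B_ij[of i j] Z n by (cases i; cases j) (auto simp: Z_def)
  qed (use B Z n in auto)
  have Z_sym: "symmetric_mat Z"
    unfolding symmetric_mat_def by (rule eq_matI) (use B_ij n in \<open>auto simp: Z_def\<close>)
  have "similar_mat X B"
    unfolding similar_mat_def
    by (rule exI[of _ H], rule exI[of _ H], rule similar_mat_witI[of _ _ n])
      (use H X B X_B in auto)
  then have "[:- e, 1:] * (\<Prod>e\<leftarrow>es. [:- e, 1:]) = char_poly B"
    using cp char_poly_similar by force
  also have "\<dots> = char_poly ?E * char_poly Z"
    unfolding B_block by (rule char_poly_four_block_zeros_col) (use Z in auto)
  also have "char_poly ?E = [:- e, 1:]"
    by (simp add: char_poly_defs det_def sign_def)
  finally have "char_poly Z = (\<Prod>e\<leftarrow>es. [:- e, 1:])"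
    by (metis mult_cancel_left pCons_eq_0_iff zero_neq_one)
  from Cons.IH[OF Z Z_sym this] obtain Q where
    Q: "Q \<in> carrier_mat m m" "Q * Q\<^sup>T = 1\<^sub>m m" and Z_Q: "Z = Q * mat_diag m ((!) es) * Q\<^sup>T"
    by blast
  define R where "R = four_block_mat (1\<^sub>m 1) (0\<^sub>m 1 m) (0\<^sub>m m 1) Q"
  have R: "R \<in> carrier_mat n n" using Q n by (auto simp: R_def intro!: carrier_matI)
  have Rt: "R\<^sup>T = four_block_mat (1\<^sub>m 1) (0\<^sub>m 1 m) (0\<^sub>m m 1) Q\<^sup>T"
    unfolding R_def using Q by (subst transpose_four_block_mat[of _ 1 1 _ m _ m]) auto
  let ?D = "mat_diag n ((!) (e # es))" and ?D' = "mat_diag m ((!) es)"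
  have D: "?D = four_block_mat ?E (0\<^sub>m 1 m) (0\<^sub>m m 1) ?D'"
    by (rule eq_matI) (auto simp: mat_diag_def n nth_Cons' split: if_splits)
  have R_orth: "R * R\<^sup>T = 1\<^sub>m n"
    unfolding Rt unfolding R_def using Q n
    by (subst mult_four_block_mat[of _ 1 1 _ m _ m _ _ 1 _ m]) auto
  have "R * ?D = four_block_mat ?E (0\<^sub>m 1 m) (0\<^sub>m m 1) (Q * ?D')"
    unfolding R_def D using Q
    by (subst mult_four_block_mat[of _ 1 1 _ m _ m _ _ 1 _ m])
      (auto simp: left_mult_zero_mat[OF mat_diag_dim])
  moreover have QD: "Q * ?D' \<in> carrier_mat m m" "Q * ?D' * Q\<^sup>T \<in> carrier_mat m m"
    using Q mat_diag_dim by (auto intro!: mult_carrier_mat)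
  ultimately have "R * ?D * R\<^sup>T = four_block_mat ?E (0\<^sub>m 1 m) (0\<^sub>m m 1) (Q * ?D' * Q\<^sup>T)"
    unfolding Rt using Q
    by (simp, subst mult_four_block_mat[of _ 1 1 _ m _ m _ _ 1 _ m])
      (auto simp: right_mult_zero_mat[OF QD(1)] left_add_zero_mat[OF QD(2)])
  then have B_R: "B = R * ?D * R\<^sup>T"
    by (simp add: B_block Z_Q)
  have HRt: "(H * R)\<^sup>T = R\<^sup>T * H"
    using H R by (simp add: transpose_mult[of _ n n _ n])
  have "(H * R) * (H * R)\<^sup>T = H * (R * R\<^sup>T) * H"
    unfolding HRt using H R by (simp add: assoc_mult_mat[of _ n n _ n _ n])
  then have "(H * R) * (H * R)\<^sup>T = 1\<^sub>m n" using H by (simp add: R_orth)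
  moreover have "X = (H * R) * ?D * (H * R)\<^sup>T"
    unfolding HRt using H R
    by (subst X_B) (simp add: B_R assoc_mult_mat[of _ n n _ n _ n] mult_carrier_mat[of _ n n _ n])
  ultimately show ?case using H R by (intro bexI[of _ "H * R"]) auto
qed

section \<open>Diagonals and eigenvalues\<close>

text \<open>
  Schur's observation: the weights are the squared entries of an orthogonal diagonalising matrix,
  whose rows and columns are unit vectors.
\<close>
lemma diag_doubly_stochastic_image_eigenvalues:
  assumes X: "X \<in> carrier_mat n n" and sym: "symmetric_mat X" and l: "eigenvalue_vec X l"
  obtains S where "doubly_stochastic n S" "\<And>i. i < n \<Longrightarrow> X $$ (i, i) = (\<Sum>k<n. S i k * l $ k)"
proof -
  have dim: "dim_vec l = n" and cp: "char_poly X = (\<Prod>e\<leftarrow>list_of_vec l. [:- e, 1:])"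
    using eigenvalue_vec_char_poly[OF X sym l] by auto
  obtain P where P: "P \<in> carrier_mat n n" "P * P\<^sup>T = 1\<^sub>m n"
    and X_P: "X = P * mat_diag n ((!) (list_of_vec l)) * P\<^sup>T"
    using spectral_theorem_real_symmetric[OF X sym cp] by blast
  have P': "P\<^sup>T * P = 1\<^sub>m n"
    using mat_mult_left_right_inverse[of P n "P\<^sup>T"] P by simp
  show ?thesis
  proof (rule that)
    have "(\<Sum>k<n. (P $$ (i, k))\<^sup>2) = 1" if "i < n" for i
      using arg_cong[OF P(2), of "\<lambda>A. A $$ (i, i)"] P(1) that
      by (simp add: scalar_prod_def atLeast0LessThan power2_eq_square)
    moreover have "(\<Sum>i<n. (P $$ (i, k))\<^sup>2) = 1" if "k < n" for k
      using arg_cong[OF P', of "\<lambda>A. A $$ (k, k)"] P(1) that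
      by (simp add: scalar_prod_def atLeast0LessThan power2_eq_square)
    ultimately show "doubly_stochastic n (\<lambda>i k. (P $$ (i, k))\<^sup>2)"
      by (simp add: doubly_stochastic_def)
    show "X $$ (i, i) = (\<Sum>k<n. (P $$ (i, k))\<^sup>2 * l $ k)" if "i < n" for i
      using that P(1) dim unfolding X_P
      by (simp add: mat_diag_mult_right[of _ n] scalar_prod_def atLeast0LessThan
          power2_eq_square ac_simps list_of_vec_index)
  qed
qed

text \<open>
  The two cases of the theorem differ only by exchanging \<open>X\<close> and \<open>Y\<close>; this is one of them.
\<close>
lemma symmetric_diag_inequality:
  assumes X: "X \<in> carrier_mat n n" and Y: "Y \<in> carrier_mat n n"
    and symX: "symmetric_mat X" and symY: "symmetric_mat Y"
    and lX: "eigenvalue_vec X a" and lY: "eigenvalue_vec Y b"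
    and dec: "vec_decreasing a" and inc: "vec_increasing b"
  shows "vec_norm (diag_vec X) * vec_norm (diag_vec Y) - diag_vec X \<bullet> diag_vec Y
           \<le> vec_norm a * vec_norm b - a \<bullet> b"
proof -
  have dims: "dim_vec a = n" "dim_vec b = n"
    using eigenvalue_vec_char_poly(1) X Y symX symY lX lY by blast+
  obtain S where S: "doubly_stochastic n S"
    and x: "\<And>i. i < n \<Longrightarrow> X $$ (i, i) = (\<Sum>k<n. S i k * a $ k)"
    using diag_doubly_stochastic_image_eigenvalues[OF X symX lX] by blast
  obtain T where T: "doubly_stochastic n T"
    and y: "\<And>i. i < n \<Longrightarrow> Y $$ (i, i) = (\<Sum>k<n. T i k * b $ k)"
    using diag_doubly_stochastic_image_eigenvalues[OF Y symY lY] by blast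
  have prod_diag: "diag_vec A \<bullet> diag_vec B = (\<Sum>i<n. A $$ (i, i) * B $$ (i, i))"
    if "A \<in> carrier_mat n n" "B \<in> carrier_mat n n" for A B :: "real mat"
    using that by (simp add: diag_vec_def diag_mat_def scalar_prod_def atLeast0LessThan vec_of_list_index)
  have prod_ev: "u \<bullet> b = (\<Sum>k<n. u $ k * b $ k)" "u \<bullet> a = (\<Sum>k<n. u $ k * a $ k)" for u
    using dims by (simp_all add: scalar_prod_def atLeast0LessThan)
  have nX: "vec_norm (diag_vec X) \<le> vec_norm a"
    using doubly_stochastic_sum_squares_le[OF S, of "($) a"] dims
    by (simp add: vec_norm_def prod_diag[OF X X] x prod_ev power2_eq_square)
  have nY: "vec_norm (diag_vec Y) \<le> vec_norm b"
    using doubly_stochastic_sum_squares_le[OF T, of "($) b"] dims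
    by (simp add: vec_norm_def prod_diag[OF Y Y] y prod_ev power2_eq_square)
  have "a \<bullet> b = (\<Sum>k<n. a $ k * b $ k)"
    by (rule prod_ev)
  also have "\<dots> \<le> (\<Sum>i<n. (\<Sum>k<n. S i k * a $ k) * (\<Sum>l<n. T i l * b $ l))"
  proof (rule sum_doubly_stochastic_images_ge[OF S T])
    fix i j assume "i \<le> j" "j < n"
    then show "a $ j \<le> a $ i"
      using dec dims sorted_wrt_nth_less[of "(\<ge>)" "list_of_vec a" i j]
      by (cases "i = j") (auto simp: vec_decreasing_def list_of_vec_index)
    show "b $ i \<le> b $ j"
      using inc dims sorted_wrt_nth_less[of "(\<le>)" "list_of_vec b" i j] \<open>i \<le> j\<close> \<open>j < n\<close>
      by (cases "i = j") (auto simp: vec_increasing_def list_of_vec_index)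
  qed
  also have "\<dots> = diag_vec X \<bullet> diag_vec Y"
    by (simp add: prod_diag[OF X Y] x y)
  finally have inner: "a \<bullet> b \<le> diag_vec X \<bullet> diag_vec Y" .
  have nonneg: "0 \<le> vec_norm v" for v
    by (simp add: vec_norm_def scalar_prod_def sum_nonneg)
  have "vec_norm (diag_vec X) * vec_norm (diag_vec Y) \<le> vec_norm a * vec_norm b"
    using nX nY nonneg by (intro mult_mono)
  with inner show ?thesis by linarith
qed

theorem corollary2p2:
  fixes n :: nat and X Y :: "real mat" and l\<^sub>X l\<^sub>Y :: "real vec"
  assumes "X \<in> carrier_mat n n" and "Y \<in> carrier_mat n n"
    and "symmetric_mat X" and "symmetric_mat Y"
    and "eigenvalue_vec X l\<^sub>X" and "eigenvalue_vec Y l\<^sub>Y"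
    and "(vec_decreasing l\<^sub>X \<and> vec_increasing l\<^sub>Y) \<or> (vec_increasing l\<^sub>X \<and> vec_decreasing l\<^sub>Y)"
  shows "vec_norm (diag_vec X) * vec_norm (diag_vec Y) - diag_vec X \<bullet> diag_vec Y
           \<le> vec_norm l\<^sub>X * vec_norm l\<^sub>Y - l\<^sub>X \<bullet> l\<^sub>Y"
  using assms(7)
proof
  assume "vec_decreasing l\<^sub>X \<and> vec_increasing l\<^sub>Y"
  with assms(1-6) show ?thesis by (intro symmetric_diag_inequality) auto
next
  assume "vec_increasing l\<^sub>X \<and> vec_decreasing l\<^sub>Y"
  with assms(1-6) have "vec_norm (diag_vec Y) * vec_norm (diag_vec X) - diag_vec Y \<bullet> diag_vec X
      \<le> vec_norm l\<^sub>Y * vec_norm l\<^sub>X - l\<^sub>Y \<bullet> l\<^sub>X"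
    by (intro symmetric_diag_inequality) auto
  moreover have "dim_vec l\<^sub>X = n" "dim_vec l\<^sub>Y = n"
    using eigenvalue_vec_char_poly(1) assms by blast+
  then have "l\<^sub>Y \<bullet> l\<^sub>X = l\<^sub>X \<bullet> l\<^sub>Y"
    by (intro comm_scalar_prod[of _ n]) (auto intro: carrier_vecI)
  moreover have "diag_vec X \<in> carrier_vec n" "diag_vec Y \<in> carrier_vec n"
    using assms(1,2) by (auto simp: diag_vec_def diag_mat_def intro!: carrier_vecI)
  then have "diag_vec Y \<bullet> diag_vec X = diag_vec X \<bullet> diag_vec Y"
    by (rule comm_scalar_prod[rotated])
  ultimately show ?thesis by (simp add: mult.commute)
qed

end
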